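(* Let $E$ be a quasi-Banach ideal space with the Fatou property over $(T,\Sigma,\mu)$ and let $\varphi$ be an Orlicz function with $a_\varphi<b_\varphi$ and $\alpha^E_\varphi>0$. Suppose $\mu$ is nonatomic and $E_a\neq\{0\}$. If $\varphi\notin\Delta_2(\infty)$, then the space $E_\varphi$ contains an order linearly isometric copy of $l_\infty$.
   Context: $(T,\Sigma,\mu)$ is a complete $\sigma$-finite measure space with $\mu(T)>0$; $L^0$ is the space of ($\mu$-a.e. classes of) real $\Sigma$-measurable functions on $T$, with the a.e. order; $L_\infty=L_\infty(T,\Sigma,\mu)$. A quasi-norm is a functional satisfying the axioms of a norm with the triangle inequality replaced by $\|x+y\|\le C(\|x\|+\|y\|)$ for some constant $C\ge1$. A quasi-Banach ideal space is a linear subspace $E\subset L^0$ with a complete quasi-norm $\|\cdot\|_E$ such that (i) $x\in L^0$, $y\in E$, $|x|\le|y|$ a.e. imply $x\in E$, $\|x\|_E\le\|y\|_E$; (ii) some $x\in E$ is strictly positive on $T$. $E$ has the Fatou property if $0\le x_n\uparrow|x|$ a.e., $x_n\in E$, $x\in L^0$, $\sup_n\|x_n\|_E<\infty$ imply $x\in E$ and $\|x_n\|_E\to\|x\|_E$. $E_a$ is the set of order continuous elements: those $x\in E$ such that $\|x_n\|_E\to0$ for every sequence with $0\le x_n\le|x|$ and $x_n\to0$ a.e. An Orlicz function is a non-decreasing $\varphi:[0,\infty)\to[0,\infty]$ with $\varphi(0)=0$, right continuous at $0$, continuous on $(0,b_\varphi)$ and left continuous at $b_\varphi$, where $b_\varphi=\sup\{u\ge0:\varphi(u)<\infty\}$,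 and with $\lim_{u\to\infty}\varphi(u)=\infty$. $a_\varphi=\sup\{u\ge0:\varphi(u)=0\}$. $\varphi\in\Delta_2(\infty)$ means: there are $K,u_0\in(0,\infty)$ with $\varphi(u_0)<\infty$ and $\varphi(2u)\le K\varphi(u)$ for all $u\ge u_0$. Indices: $\alpha^a_\varphi$ is the supremum of $p\in\mathbb R$ for which there is $K\ge1$ with $\varphi(au)\le Ka^p\varphi(u)$ for all $u\ge0$, $0<a\le1$; $\alpha^\infty_\varphi$ is the same with the inequality required only for $u\ge u_0$, for some $u_0>0$ with $\varphi(u_0)<\infty$; $\alpha^0_\varphi$ is the same with the inequality required only for $0\le u\le u_0$, for some $u_0>0$. $\alpha^E_\varphi=\alpha^a_\varphi$ if neither $L_\infty\subset E$ nor $E\subset L_\infty$; $\alpha^E_\varphi=\alpha^\infty_\varphi$ if $L_\infty\subset E$; $\alpha^E_\varphi=\alpha^0_\varphi$ if $E\subset L_\infty$ (if $E=L_\infty$ as sets, either of the last two). $\rho^E_\varphi(x)=\|\varphi(|x|)\|_E$ if $\varphi(|x|)\in E$, and $=\infty$ otherwise; $E_\varphi=\{x\in L^0:\rho^E_\varphi(\lambda x)<\infty\text{ for some }\lambda>0\}$ with the quasi-norm $\|x\|_\varphi=\inf\{\lambda>0:\rho^E_\varphi(x/\lambda)\le1\}$. A quasi-normed ideal space $F$ contains an order linearly isometric copy of $l_\infty$ if there is a linear map $P:l_\infty\to F$ with $\|Pz\|_F=\|z\|_{l_\infty}$ and $|Pz|=P|z|$ for all $z\in l_\infty$ (in particular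 $Pz\ge0$ when $z\ge0$). *)

theory Defs
  imports "HOL-Analysis.Analysis"
begin

text \<open>
  Elements of $L^0$ are represented by measurable functions \<^typ>\<open>'a \<Rightarrow> real\<close>; equality, order and
  convergence are understood almost everywhere. A space of classes is represented by the set of all
  representatives of its elements.
\<close>

definition null_functions :: "'a measure \<Rightarrow> ('a \<Rightarrow> real) set" where
  "null_functions M = {x \<in> borel_measurable M. AE t in M. x t = 0}"

definition L_infinity :: "'a measure \<Rightarrow> ('a \<Rightarrow> real) set" where
  "L_infinity M = {x \<in> borel_measurable M. \<exists>c. AE t in M. \<bar>x t\<bar> \<le> c}"

definition nonatomic :: "'a measure \<Rightarrow> bool" where
  "nonatomic M \<longleftrightarrow> (\<forall>A\<in>sets M. emeasure M A > 0 \<longrightarrow>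
     (\<exists>B\<in>sets M. B \<subseteq> A \<and> 0 < emeasure M B \<and> emeasure M B < emeasure M A))"

definition function_subspace :: "('a \<Rightarrow> real) set \<Rightarrow> bool" where
  "function_subspace E \<longleftrightarrow> (\<lambda>t. 0) \<in> E \<and>
     (\<forall>x\<in>E. \<forall>y\<in>E. (\<lambda>t. x t + y t) \<in> E) \<and> (\<forall>x\<in>E. \<forall>c. (\<lambda>t. c * x t) \<in> E)"

definition quasi_norm_on :: "'a measure \<Rightarrow> ('a \<Rightarrow> real) set \<Rightarrow> (('a \<Rightarrow> real) \<Rightarrow> real) \<Rightarrow> bool" where
  "quasi_norm_on M E N \<longleftrightarrow>
     (\<forall>x\<in>E. 0 \<le> N x) \<and>
     (\<forall>x\<in>E. N x = 0 \<longleftrightarrow> (AE t in M. x t = 0)) \<and>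
     (\<forall>x\<in>E. \<forall>c. N (\<lambda>t. c * x t) = \<bar>c\<bar> * N x) \<and>
     (\<exists>C\<ge>1. \<forall>x\<in>E. \<forall>y\<in>E. N (\<lambda>t. x t + y t) \<le> C * (N x + N y))"

definition complete_quasi_norm :: "('a \<Rightarrow> real) set \<Rightarrow> (('a \<Rightarrow> real) \<Rightarrow> real) \<Rightarrow> bool" where
  "complete_quasi_norm E N \<longleftrightarrow>
     (\<forall>X :: nat \<Rightarrow> 'a \<Rightarrow> real. (\<forall>n. X n \<in> E) \<and>
        (\<forall>e>0. \<exists>n0. \<forall>m\<ge>n0. \<forall>n\<ge>n0. N (\<lambda>t. X m t - X n t) < e) \<longrightarrow>
        (\<exists>x\<in>E. (\<lambda>n. N (\<lambda>t. X n t - x t)) \<longlonglongrightarrow> 0))"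

text \<open>
  The ideal property below also makes \<open>E\<close> and \<open>N\<close> invariant under almost everywhere equality.
\<close>

definition quasi_Banach_ideal_space ::
    "'a measure \<Rightarrow> ('a \<Rightarrow> real) set \<Rightarrow> (('a \<Rightarrow> real) \<Rightarrow> real) \<Rightarrow> bool" where
  "quasi_Banach_ideal_space M E N \<longleftrightarrow>
     E \<subseteq> borel_measurable M \<and> function_subspace E \<and> quasi_norm_on M E N \<and>
     complete_quasi_norm E N \<and>
     (\<forall>x\<in>borel_measurable M. \<forall>y\<in>E. (AE t in M. \<bar>x t\<bar> \<le> \<bar>y t\<bar>) \<longrightarrow> x \<in> E \<and> N x \<le> N y) \<and>
     (\<exists>x\<in>E. AE t in M. 0 < x t)"

definition Fatou_property ::
    "'a measure \<Rightarrow> ('a \<Rightarrow> real) set \<Rightarrow> (('a \<Rightarrow> real) \<Rightarrow> real) \<Rightarrow> bool" where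
  "Fatou_property M E N \<longleftrightarrow>
     (\<forall>X. \<forall>x\<in>borel_measurable M.
        (\<forall>n. X n \<in> E) \<and>
        (AE t in M. (\<forall>n. 0 \<le> X n t) \<and> incseq (\<lambda>n. X n t) \<and> (\<lambda>n. X n t) \<longlonglongrightarrow> \<bar>x t\<bar>) \<and>
        bdd_above (range (\<lambda>n. N (X n))) \<longrightarrow>
        x \<in> E \<and> (\<lambda>n. N (X n)) \<longlonglongrightarrow> N x)"

definition order_continuous_part ::
    "'a measure \<Rightarrow> ('a \<Rightarrow> real) set \<Rightarrow> (('a \<Rightarrow> real) \<Rightarrow> real) \<Rightarrow> ('a \<Rightarrow> real) set" where
  "order_continuous_part M E N = {x \<in> E. \<forall>X.
     (\<forall>n. X n \<in> borel_measurable M) \<and>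
     (\<forall>n. AE t in M. 0 \<le> X n t \<and> X n t \<le> \<bar>x t\<bar>) \<and>
     (AE t in M. (\<lambda>n. X n t) \<longlonglongrightarrow> 0) \<longrightarrow>
     (\<lambda>n. N (X n)) \<longlonglongrightarrow> 0}"

text \<open>
  Orlicz functions are used only on $[0,\infty)$; their values at negative arguments are irrelevant.
\<close>

definition b_phi :: "(real \<Rightarrow> ennreal) \<Rightarrow> ereal" where
  "b_phi \<phi> = Sup (ereal ` {u. 0 \<le> u \<and> \<phi> u < \<infinity>})"

definition a_phi :: "(real \<Rightarrow> ennreal) \<Rightarrow> ereal" where
  "a_phi \<phi> = Sup (ereal ` {u. 0 \<le> u \<and> \<phi> u = 0})"

definition Orlicz_function :: "(real \<Rightarrow> ennreal) \<Rightarrow> bool" where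
  "Orlicz_function \<phi> \<longleftrightarrow>
     mono_on {0..} \<phi> \<and> \<phi> 0 = 0 \<and>
     continuous (at_right 0) \<phi> \<and>
     continuous_on {u. 0 < u \<and> ereal u < b_phi \<phi>} \<phi> \<and>
     (\<forall>b. b_phi \<phi> = ereal b \<longrightarrow> continuous (at_left b) \<phi>) \<and>
     (\<phi> \<longlongrightarrow> \<infinity>) at_top"

definition Delta2_infinity :: "(real \<Rightarrow> ennreal) \<Rightarrow> bool" where
  "Delta2_infinity \<phi> \<longleftrightarrow>
     (\<exists>K>0. \<exists>u0>0. \<phi> u0 < \<infinity> \<and> (\<forall>u\<ge>u0. \<phi> (2 * u) \<le> ennreal K * \<phi> u))"

definition power_bound_on :: "(real \<Rightarrow> ennreal) \<Rightarrow> real set \<Rightarrow> real \<Rightarrow> bool" where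
  "power_bound_on \<phi> U p \<longleftrightarrow>
     (\<exists>K\<ge>1. \<forall>u\<in>U. \<forall>a. 0 < a \<and> a \<le> 1 \<longrightarrow> \<phi> (a * u) \<le> ennreal (K * a powr p) * \<phi> u)"

definition alpha_all :: "(real \<Rightarrow> ennreal) \<Rightarrow> ereal" where
  "alpha_all \<phi> = Sup (ereal ` {p. power_bound_on \<phi> {0..} p})"

definition alpha_infinity :: "(real \<Rightarrow> ennreal) \<Rightarrow> ereal" where
  "alpha_infinity \<phi> = Sup (ereal ` {p. \<exists>u0>0. \<phi> u0 < \<infinity> \<and> power_bound_on \<phi> {u0..} p})"

definition alpha_zero :: "(real \<Rightarrow> ennreal) \<Rightarrow> ereal" where
  "alpha_zero \<phi> = Sup (ereal ` {p. \<exists>u0>0. power_bound_on \<phi> {0..u0} p})"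

text \<open>
  The index of \<open>\<phi>\<close> relative to \<open>E\<close> is given as a relation because for $E = L_\infty$ both of the last
  two values are admissible.
\<close>

definition is_alpha_E ::
    "'a measure \<Rightarrow> ('a \<Rightarrow> real) set \<Rightarrow> (real \<Rightarrow> ennreal) \<Rightarrow> ereal \<Rightarrow> bool" where
  "is_alpha_E M E \<phi> \<alpha> \<longleftrightarrow>
     (\<not> L_infinity M \<subseteq> E \<and> \<not> E \<subseteq> L_infinity M \<and> \<alpha> = alpha_all \<phi>) \<or>
     (L_infinity M \<subseteq> E \<and> \<alpha> = alpha_infinity \<phi>) \<or>
     (E \<subseteq> L_infinity M \<and> \<alpha> = alpha_zero \<phi>)"

text \<open>
  $\varphi(|x|)$ may take the value $\infty$, so it belongs to \<open>E\<close> iff it is finite almost everywhere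
  and its real-valued version belongs to \<open>E\<close>.
\<close>

definition rho ::
    "'a measure \<Rightarrow> ('a \<Rightarrow> real) set \<Rightarrow> (('a \<Rightarrow> real) \<Rightarrow> real) \<Rightarrow> (real \<Rightarrow> ennreal) \<Rightarrow>
     ('a \<Rightarrow> real) \<Rightarrow> ennreal" where
  "rho M E N \<phi> x =
     (if (AE t in M. \<phi> \<bar>x t\<bar> < \<infinity>) \<and> (\<lambda>t. enn2real (\<phi> \<bar>x t\<bar>)) \<in> E
      then ennreal (N (\<lambda>t. enn2real (\<phi> \<bar>x t\<bar>))) else \<infinity>)"

definition CL_space ::
    "'a measure \<Rightarrow> ('a \<Rightarrow> real) set \<Rightarrow> (('a \<Rightarrow> real) \<Rightarrow> real) \<Rightarrow> (real \<Rightarrow> ennreal) \<Rightarrow>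
     ('a \<Rightarrow> real) set" where
  "CL_space M E N \<phi> =
     {x \<in> borel_measurable M. \<exists>l>0. rho M E N \<phi> (\<lambda>t. l * x t) < \<infinity>}"

text \<open>
  The infimum is taken in $[0,\infty]$, so that the infimum of the empty set is $\infty$.
\<close>

definition CL_norm ::
    "'a measure \<Rightarrow> ('a \<Rightarrow> real) set \<Rightarrow> (('a \<Rightarrow> real) \<Rightarrow> real) \<Rightarrow> (real \<Rightarrow> ennreal) \<Rightarrow>
     ('a \<Rightarrow> real) \<Rightarrow> ennreal" where
  "CL_norm M E N \<phi> x =
     Inf (ennreal ` {l. 0 < l \<and> rho M E N \<phi> (\<lambda>t. x t / l) \<le> 1})"

definition l_infinity :: "(nat \<Rightarrow> real) set" where
  "l_infinity = {z. bounded (range z)}"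

definition l_infinity_norm :: "(nat \<Rightarrow> real) \<Rightarrow> real" where
  "l_infinity_norm z = (SUP n. \<bar>z n\<bar>)"

definition contains_order_isometric_l_infinity ::
    "'a measure \<Rightarrow> ('a \<Rightarrow> real) set \<Rightarrow> (('a \<Rightarrow> real) \<Rightarrow> ennreal) \<Rightarrow> bool" where
  "contains_order_isometric_l_infinity M F NF \<longleftrightarrow>
     (\<exists>P :: (nat \<Rightarrow> real) \<Rightarrow> 'a \<Rightarrow> real.
        (\<forall>z\<in>l_infinity. P z \<in> F) \<and>
        (\<forall>z\<in>l_infinity. \<forall>w\<in>l_infinity. AE t in M. P (\<lambda>n. z n + w n) t = P z t + P w t) \<and>
        (\<forall>z\<in>l_infinity. \<forall>c. AE t in M. P (\<lambda>n. c * z n) t = c * P z t) \<and>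
        (\<forall>z\<in>l_infinity. NF (P z) = ennreal (l_infinity_norm z)) \<and>
        (\<forall>z\<in>l_infinity. AE t in M. \<bar>P z t\<bar> = P (\<lambda>n. \<bar>z n\<bar>) t))"

end

theory Submission
  imports Defs
begin

text \<open>
  A copy of $l_\infty$ comes from one function $s \ge 0$ with $\rho(s) \le 1$ and disjoint sets
  $G_n$ such that $\rho(\lambda s \chi_{G_n}) > 1$ for all $n$ and all $\lambda > 1$: the map
  $Pz = s \sum_n z_n \chi_{G_n}$ is then an order isometry, because $|Pz| \le \|z\| s$ bounds the norm
  of $Pz$ from above, and $|Pz| \ge |z_n| s \chi_{G_n}$ bounds it from below
  (\<open>order_isometric_l_infinityI\<close>).

  Such an $s$ takes values $u_j$ on disjoint sets $B_j$ for which $\varphi(u_j)\|\chi_{B_j}\|$ is tiny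
  while $\varphi(\lambda_j u_j)\|\chi_{B_j}\| > 1$ for some $\lambda_j > 1$. Each $G_n$ is a union of
  infinitely many $B_j$ along which $\lambda_j \to 1$, so every $\lambda > 1$ exceeds one of these
  $\lambda_j$. Two facts supply $u_j$ and $B_j$.

  First, failure of the doubling condition gives failure of $\varphi(\lambda u) \le K \varphi(u)$ for
  every $\lambda > 1$ and every $K$, at some finite value $\varphi(u)$: otherwise iteration up to
  $\lambda^n \ge 2$ would give the doubling condition (\<open>not_Delta2_growth\<close>). The value
  $\varphi(\lambda u)$ may be infinite, so finite and infinite $b_\varphi$ need no separate treatment.

  Second, $B \mapsto \|\chi_B\|$ need not be additive or continuous, so sets of exactly prescribed size
  are not available. Sets whose size is right up to the factor $2C$ suffice, where $C$ is the constant
  of the quasi-norm. They are found inside a set on which the quasi-norm is order continuous by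
  exhausting it greedily by small pieces (\<open>subset_of_comparable_size\<close>).

  The quasi-norms of the pieces of $\varphi(s)$ decay like $(2C)^{-j}$, which compensates the factor $C$
  paid at each use of the quasi-triangle inequality. The Fatou property carries the bound for
  finite sums over to $\varphi(s)$ (\<open>rho_step_function_le_1\<close>).
\<close>

section \<open>Growth of Orlicz functions without the doubling condition\<close>

lemma upward_closed_borel:
  fixes U :: "real set"
  assumes up: "\<And>v w. v \<in> U \<Longrightarrow> v \<le> w \<Longrightarrow> w \<in> U"
  shows "U \<in> sets borel"
proof (cases "U = {} \<or> \<not> bdd_below U")
  case True
  then have "U = {} \<or> U = UNIV"
    using up by (auto simp: bdd_below_def) (meson linear)
  then show ?thesis by auto
next
  case False
  then have ne: "U \<noteq> {}" and bd: "bdd_below U" by auto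
  have lo: "Inf U \<le> v" if "v \<in> U" for v using cInf_lower[OF that bd] .
  have hi: "w \<in> U" if "Inf U < w" for w
    using cInf_lessD[OF ne that] up by (meson less_imp_le)
  have "U = (if Inf U \<in> U then {Inf U..} else {Inf U<..})"
    using lo hi by (auto simp: order.order_iff_strict) 
  then show ?thesis by (metis atLeast_borel greaterThan_borel)
qed

text \<open>
  The superlevel sets of $v \mapsto \varphi(\max(0,v))$ are upward closed, hence rays.
\<close>

lemma borel_measurable_mono_on_nonneg_abs:
  fixes \<phi> :: "real \<Rightarrow> ennreal"
  assumes "mono_on {0..} \<phi>"
  shows "(\<lambda>v. \<phi> \<bar>v\<bar>) \<in> borel_measurable borel"
proof -
  have "(\<lambda>v. \<phi> (max 0 v)) \<in> borel_measurable borel"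
  proof (rule borel_measurableI_greater)
    fix y
    have "{v. y < \<phi> (max 0 v)} \<in> sets borel"
    proof (rule upward_closed_borel)
      fix v w assume "v \<in> {v. y < \<phi> (max 0 v)}" "v \<le> w"
      moreover from \<open>v \<le> w\<close> have "\<phi> (max 0 v) \<le> \<phi> (max 0 w)"
        by (intro mono_onD[OF assms]) auto
      ultimately show "w \<in> {v. y < \<phi> (max 0 v)}" by auto
    qed
    then show "{v \<in> space borel. y < \<phi> (max 0 v)} \<in> sets borel" by simp
  qed
  from measurable_compose[OF _ this, of abs borel] show ?thesis by simp
qed

lemma obtain_pos_finite_value:
  assumes "mono_on {0..} \<phi>" "\<phi> 0 = 0" "a_phi \<phi> < b_phi \<phi>"
  obtains u where "0 < u" "0 < \<phi> u" "\<phi> u < \<infinity>"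
proof -
  obtain v where v: "0 \<le> v" "\<phi> v < \<infinity>" "a_phi \<phi> < ereal v"
    using assms(3) unfolding b_phi_def less_Sup_iff by auto
  have "\<phi> v \<noteq> 0"
  proof
    assume "\<phi> v = 0"
    then have "ereal v \<le> a_phi \<phi>"
      unfolding a_phi_def using v(1) by (intro Sup_upper) auto
    then show False using v(3) by simp
  qed
  moreover have "v \<noteq> 0" using calculation assms(2) by auto
  ultimately show ?thesis using that[of v] v by (simp add: zero_less_iff_neq_zero)
qed

text \<open>
  An inequality $\varphi(lu) \le K \varphi(u)$ for all $u \ge u_0$ with $\varphi(u) < \infty$ can be
  iterated. It then shows at once that $\varphi$ is finite everywhere and, once $l^n \ge 2$, that
  $\varphi$ satisfies the doubling condition with the constant $K^n$.
\<close>

lemma not_Delta2_growth: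
  fixes \<phi> :: "real \<Rightarrow> ennreal"
  assumes mono: "mono_on {0..} \<phi>" and u0: "0 < u0" "\<phi> u0 < \<infinity>"
    and nD: "\<not> Delta2_infinity \<phi>" and l: "1 < l" and K: "0 < K"
  shows "\<exists>u\<ge>u0. \<phi> u < \<infinity> \<and> ennreal K * \<phi> u < \<phi> (l * u)"
proof (rule ccontr)
  assume "\<not> ?thesis"
  then have step: "\<phi> (l * u) \<le> ennreal K * \<phi> u" if "u0 \<le> u" "\<phi> u < \<infinity>" for u
    using that by (meson leI)
  have iter: "\<phi> (l ^ n * u) < \<infinity> \<and> \<phi> (l ^ n * u) \<le> ennreal (K ^ n) * \<phi> u"
    if u: "u0 \<le> u" "\<phi> u < \<infinity>" for n u
  proof (induction n)
    case 0
    then show ?case using u by simp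
  next
    case (Suc n)
    have "1 \<le> l ^ n" using l by simp
    then have "u0 \<le> l ^ n * u"
      using u u0 by (smt (verit) mult_le_cancel_right1)
    then have le: "\<phi> (l * (l ^ n * u)) \<le> ennreal K * \<phi> (l ^ n * u)"
      using step Suc by blast
    also have "\<dots> \<le> ennreal K * (ennreal (K ^ n) * \<phi> u)"
      using Suc by (intro mult_left_mono) auto
    also have "\<dots> = ennreal (K ^ Suc n) * \<phi> u"
      using K by (simp add: ennreal_mult mult.assoc)
    finally have "\<phi> (l ^ Suc n * u) \<le> ennreal (K ^ Suc n) * \<phi> u" by (simp add: mult.assoc)
    moreover have "ennreal (K ^ Suc n) * \<phi> u < \<infinity>"
      using u by (simp add: ennreal_mult_less_top)
    ultimately show ?case by (meson le_less_trans)
  qed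
  have fin: "\<phi> u < \<infinity>" if "u0 \<le> u" for u
  proof -
    obtain n where n: "u / u0 < l ^ n" using real_arch_pow[OF l] by blast
    then have "u \<le> l ^ n * u0" using u0 by (simp add: field_simps)
    then have "\<phi> u \<le> \<phi> (l ^ n * u0)"
      using that u0 by (intro mono_onD[OF mono]) auto
    then show ?thesis using iter[of u0 n] u0 by (meson le_less_trans order_refl)
  qed
  obtain n where n: "2 < l ^ n" using real_arch_pow[OF l] by blast
  have "\<phi> (2 * u) \<le> ennreal (K ^ n) * \<phi> u" if "u0 \<le> u" for u
  proof -
    have "2 * u \<le> l ^ n * u" using n that u0 by (intro mult_right_mono) auto
    then have "\<phi> (2 * u) \<le> \<phi> (l ^ n * u)"
      using that u0 by (intro mono_onD[OF mono]) auto
    also have "\<dots> \<le> ennreal (K ^ n) * \<phi> u" using iter[OF that fin[OF that]] by blast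
    finally show ?thesis .
  qed
  moreover have "0 < K ^ n" using K by simp
  ultimately show False using nD u0 unfolding Delta2_infinity_def by blast
qed

section \<open>Sets of prescribed size in nonatomic measures\<close>

text \<open>
  Nonatomicity gives a strictly decreasing sequence of sets whose successive differences are not null.
  An infinite set can be split as well: the part that is split off has smaller measure, so
  what remains cannot be null.
\<close>

lemma nonatomic_disjoint_positive_subsets:
  assumes na: "nonatomic M" and A: "A \<in> sets M" "0 < emeasure M A"
  obtains Q :: "nat \<Rightarrow> 'a set" where "disjoint_family Q"
    "\<And>n. Q n \<in> sets M" "\<And>n. Q n \<subseteq> A" "\<And>n. 0 < emeasure M (Q n)"
proof -
  have "\<exists>R. \<forall>n. (R n \<in> sets M \<and> R n \<subseteq> A \<and> 0 < emeasure M (R n)) \<and>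
      R (Suc n) \<subseteq> R n \<and> 0 < emeasure M (R n - R (Suc n))"
  proof (rule dependent_nat_choice)
    show "\<exists>x. x \<in> sets M \<and> x \<subseteq> A \<and> 0 < emeasure M x" using A by blast
  next
    fix x and n :: nat
    assume x: "x \<in> sets M \<and> x \<subseteq> A \<and> 0 < emeasure M x"
    then obtain y where y: "y \<in> sets M" "y \<subseteq> x" "0 < emeasure M y" "emeasure M y < emeasure M x"
      using na unfolding nonatomic_def by blast
    have "emeasure M (x - y) \<noteq> 0"
    proof
      assume z: "emeasure M (x - y) = 0"
      have "emeasure M x = emeasure M (y \<union> (x - y))" using y by (simp add: Un_absorb1)
      also have "\<dots> \<le> emeasure M y + emeasure M (x - y)"
        using x y by (intro emeasure_subadditive) auto
      finally show False using z y by simp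
    qed
    then show "\<exists>y. (y \<in> sets M \<and> y \<subseteq> A \<and> 0 < emeasure M y) \<and> y \<subseteq> x \<and> 0 < emeasure M (x - y)"
      using x y by (intro exI[of _ y]) (auto simp: zero_less_iff_neq_zero)
  qed
  then obtain R :: "nat \<Rightarrow> 'a set" where
    R: "\<And>n. R n \<in> sets M" "\<And>n. R n \<subseteq> A" "\<And>n. R (Suc n) \<subseteq> R n" "\<And>n. 0 < emeasure M (R n - R (Suc n))"
    by blast
  have dec: "R n \<subseteq> R m" if "m \<le> n" for m n
    using that R(3) by (rule lift_Suc_antimono_le[rotated])
  have "disjoint_family (\<lambda>n. R n - R (Suc n))"
    unfolding disjoint_family_on_def
  proof (intro ballI impI)
    fix m n :: nat assume "m \<noteq> n"
    then have "Suc m \<le> n \<or> Suc n \<le> m" by auto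
    then show "(R m - R (Suc m)) \<inter> (R n - R (Suc n)) = {}"
      using dec[of "Suc m" n] dec[of "Suc n" m] by auto
  qed
  then show ?thesis using R by (intro that[of "\<lambda>n. R n - R (Suc n)"]) auto
qed

lemma disjoint_family_eventually_notin:
  fixes D :: "nat \<Rightarrow> 'a set"
  assumes "disjoint_family D"
  shows "\<forall>\<^sub>F n in sequentially. t \<notin> D n"
proof (cases "\<exists>m. t \<in> D m")
  case True
  then obtain m where "t \<in> D m" by blast
  then have "t \<notin> D n" if "n > m" for n
    using disjoint_family_onD[OF assms, of m n] that by auto
  then show ?thesis using eventually_sequentiallyI[of "Suc m"] by (meson Suc_le_lessD)
qed simp

text \<open>
  A continuous set function that is only subadditive up to a constant still attains every size below
  $\nu(A)/C$ up to the factor $2C$. Pieces $D$ with $\nu(D) \le e$ are added one at a time, each at least half as large as any other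
  admissible piece. The first union to reach size $e$ is too large by a factor at most $2C$. If no
  union reached $e$, the pieces would be disjoint, so their sizes would tend to $0$ by
  continuity. Then what is left of $A$ contains no small piece of positive measure and is null, which makes
  $\nu(A) \le Ce$.
\<close>

lemma subset_of_comparable_size:
  fixes \<nu> :: "'a set \<Rightarrow> real"
  assumes na: "nonatomic M" and A: "A \<in> sets M" and C: "1 \<le> C" and e: "0 < e"
    and empty: "\<nu> {} = 0"
    and pos: "\<And>B. B \<in> sets M \<Longrightarrow> B \<subseteq> A \<Longrightarrow> 0 < emeasure M B \<Longrightarrow> 0 < \<nu> B"
    and subadd: "\<And>B D. B \<in> sets M \<Longrightarrow> D \<in> sets M \<Longrightarrow> B \<subseteq> A \<Longrightarrow> D \<subseteq> A \<Longrightarrow> \<nu> (B \<union> D) \<le> C * (\<nu> B + \<nu> D)"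
    and cont: "\<And>X. (\<And>n. X n \<in> sets M) \<Longrightarrow> (\<And>n. X n \<subseteq> A) \<Longrightarrow>
      (AE t in M. \<forall>\<^sub>F n in sequentially. t \<notin> X n) \<Longrightarrow> (\<lambda>n. \<nu> (X n)) \<longlonglongrightarrow> 0"
    and large: "C * e < \<nu> A"
  obtains B where "B \<in> sets M" "B \<subseteq> A" "e \<le> \<nu> B" "\<nu> B \<le> 2 * C * e"
proof -
  have "\<exists>B\<in>sets M. B \<subseteq> A \<and> e \<le> \<nu> B \<and> \<nu> B \<le> 2 * C * e"
  proof (rule ccontr)
    assume "\<not> ?thesis"
    \<comment> \<open>Sizes jump over the interval from \<open>e\<close> to \<open>2 * C * e\<close>, so a union of two sets of size
      at most \<open>e\<close> falls back below \<open>e\<close>.\<close>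
    then have gap: "\<nu> B < e" if "B \<in> sets M" "B \<subseteq> A" "\<nu> B \<le> 2 * C * e" for B
      using that by force
    define small where "small B = {D \<in> sets M. D \<subseteq> A - B \<and> \<nu> D \<le> e}" for B
    have "\<exists>B. \<forall>n. (B n \<in> sets M \<and> B n \<subseteq> A \<and> \<nu> (B n) < e) \<and>
      (B n \<subseteq> B (Suc n) \<and> (\<forall>D\<in>small (B n). \<nu> D \<le> 2 * \<nu> (B (Suc n) - B n)))"
    proof (rule dependent_nat_choice)
      show "\<exists>B. B \<in> sets M \<and> B \<subseteq> A \<and> \<nu> B < e" using e empty by (intro exI[of _ "{}"]) auto
    next
      fix B and n :: nat
      assume B: "B \<in> sets M \<and> B \<subseteq> A \<and> \<nu> B < e"
      have "\<exists>D\<in>small B. \<forall>D'\<in>small B. \<nu> D' \<le> 2 * \<nu> D"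
      proof (cases "\<forall>D'\<in>small B. \<nu> D' \<le> 0")
        case True
        have "{} \<in> small B" using e empty by (auto simp: small_def)
        then show ?thesis using True empty by (intro bexI[of _ "{}"]) auto
      next
        case False
        define S where "S = (SUP D\<in>small B. \<nu> D)"
        have bdd: "bdd_above (\<nu> ` small B)" by (auto simp: small_def)
        from False obtain D0 where D0: "D0 \<in> small B" "0 < \<nu> D0" by force
        then have "0 < S" unfolding S_def using cSUP_upper[OF D0(1) bdd] by linarith
        then have "\<exists>D\<in>small B. S / 2 < \<nu> D"
          using less_cSUP_iff[OF _ bdd, of "S / 2"] D0(1) by (auto simp: S_def)
        then obtain D where D: "D \<in> small B" "S / 2 < \<nu> D" by blast
        have "\<nu> D' \<le> S" if "D' \<in> small B" for D' unfolding S_def by (rule cSUP_upper[OF that bdd])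
        then show ?thesis using D by (intro bexI[of _ D]) force+
      qed
      then obtain D where D: "D \<in> sets M" "D \<subseteq> A - B" "\<nu> D \<le> e" "\<forall>D'\<in>small B. \<nu> D' \<le> 2 * \<nu> D"
        by (auto simp: small_def)
      have "\<nu> (B \<union> D) \<le> C * (\<nu> B + \<nu> D)" using B D by (intro subadd) auto
      also have "\<dots> \<le> C * (e + e)" using B D C by (intro mult_left_mono) auto
      finally have "\<nu> (B \<union> D) < e" using B D by (intro gap) auto
      moreover have "(B \<union> D) - B = D" using D by auto
      ultimately show "\<exists>y. (y \<in> sets M \<and> y \<subseteq> A \<and> \<nu> y < e) \<and>
          B \<subseteq> y \<and> (\<forall>D\<in>small B. \<nu> D \<le> 2 * \<nu> (y - B))"
        using B D by (intro exI[of _ "B \<union> D"]) auto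
    qed
    then obtain B where B: "\<And>n. B n \<in> sets M" "\<And>n. B n \<subseteq> A" "\<And>n. \<nu> (B n) < e"
      "\<And>n. B n \<subseteq> B (Suc n)" "\<And>n D. D \<in> small (B n) \<Longrightarrow> \<nu> D \<le> 2 * \<nu> (B (Suc n) - B n)"
      by blast
    define R where "R = A - (\<Union>n. B n)"
    have R: "R \<in> sets M" "R \<subseteq> A" using A B by (auto simp: R_def)
    have lim: "(\<lambda>n. \<nu> (B (Suc n) - B n)) \<longlonglongrightarrow> 0"
    proof (rule cont)
      show "AE t in M. \<forall>\<^sub>F n in sequentially. t \<notin> B (Suc n) - B n"
        by (intro AE_I2 disjoint_family_eventually_notin disjoint_family_Suc B)
    qed (use B in auto)
    have "emeasure M R = 0"
    proof (rule ccontr)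
      assume "emeasure M R \<noteq> 0"
      then obtain Q :: "nat \<Rightarrow> 'a set" where Q: "disjoint_family Q"
        "\<And>n. Q n \<in> sets M" "\<And>n. Q n \<subseteq> R" "\<And>n. 0 < emeasure M (Q n)"
        using nonatomic_disjoint_positive_subsets[OF na R(1)] by (auto simp: zero_less_iff_neq_zero)
      have QA: "Q n \<subseteq> A" for n using Q R by blast
      have "(\<lambda>n. \<nu> (Q n)) \<longlonglongrightarrow> 0"
        by (intro cont Q QA AE_I2 disjoint_family_eventually_notin)
      then have "\<forall>\<^sub>F n in sequentially. \<nu> (Q n) < e" using e by (rule order_tendstoD)
      then obtain n where n: "\<nu> (Q n) < e" by (auto simp: eventually_sequentially)
      have "Q n \<in> small (B m)" for m using n Q(2,3)[of n] by (auto simp: small_def R_def)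
      then have "\<nu> (Q n) / 2 \<le> \<nu> (B (Suc m) - B m)" for m using B(5)[of "Q n" m] by simp
      then have "\<nu> (Q n) / 2 \<le> 0" using LIMSEQ_le_const[OF lim] by blast
      then show False using pos[OF Q(2) QA Q(4), of n] by simp
    qed
    then have "R \<in> null_sets M" using R by auto
    have incB: "B m \<subseteq> B n" if "m \<le> n" for m n using that B(4) by (rule lift_Suc_mono_le[rotated])
    have "(\<lambda>n. \<nu> (A - B n)) \<longlonglongrightarrow> 0"
    proof (rule cont)
      show "AE t in M. \<forall>\<^sub>F n in sequentially. t \<notin> A - B n"
        using AE_not_in[OF \<open>R \<in> null_sets M\<close>]
      proof eventually_elim
        case (elim t)
        then have "t \<notin> A \<or> (\<exists>m. t \<in> B m)" by (auto simp: R_def)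
        then show ?case
        proof
          assume "\<exists>m. t \<in> B m"
          then obtain m where "t \<in> B m" by blast
          then show ?thesis using incB by (intro eventually_sequentiallyI[of m]) blast
        qed auto
      qed
    qed (use A B in auto)
    then have lim': "(\<lambda>n. C * (e + \<nu> (A - B n))) \<longlonglongrightarrow> C * (e + 0)" by (intro tendsto_intros)
    have "\<nu> A \<le> C * (e + 0)"
    proof (rule LIMSEQ_le_const[OF lim'], intro exI allI impI)
      fix n
      have "\<nu> A = \<nu> (B n \<union> (A - B n))" using B by (simp add: Un_absorb1)
      also have "\<dots> \<le> C * (\<nu> (B n) + \<nu> (A - B n))" using A B by (intro subadd) auto
      also have "\<dots> \<le> C * (e + \<nu> (A - B n))" using B(3)[of n] C by (intro mult_left_mono) auto
      finally show "\<nu> A \<le> C * (e + \<nu> (A - B n))" .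
    qed
    then show False using large by simp
  qed
  then show ?thesis using that by blast
qed

section \<open>Step functions on disjoint sets\<close>

lemma disjoint_indicator_sums:
  fixes f :: "nat \<Rightarrow> real"
  assumes "disjoint_family A" "t \<in> A i"
  shows "(\<lambda>n. f n * indicator (A n) t) sums f i"
proof -
  have "t \<notin> A n" if "n \<noteq> i" for n
    using disjoint_family_onD[OF assms(1), of n i] assms(2) that by auto
  then have "(\<lambda>n. f n * indicator (A n) t) = (\<lambda>n. if n = i then f n else 0)"
    using assms(2) by (auto simp: indicator_def fun_eq_iff)
  then show ?thesis using sums_single[of i f] by simp
qed

definition step_function :: "(nat \<Rightarrow> 'a set) \<Rightarrow> (nat \<Rightarrow> real) \<Rightarrow> 'a \<Rightarrow> real" where
  "step_function A f t = (\<Sum>n. f n * indicator (A n) t)"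

lemma step_function_in:
  "disjoint_family A \<Longrightarrow> t \<in> A i \<Longrightarrow> step_function A f t = f i"
  unfolding step_function_def by (rule sums_unique[symmetric, OF disjoint_indicator_sums])

lemma step_function_out: "t \<notin> (\<Union>n. A n) \<Longrightarrow> step_function A f t = 0"
  unfolding step_function_def by simp

lemma step_function_measurable:
  assumes [measurable]: "\<And>n. A n \<in> sets M"
  shows "step_function A f \<in> borel_measurable M"
  unfolding step_function_def[abs_def] by measurable

section \<open>Quasi-Banach ideal spaces and the modular\<close>

locale quasi_Banach_ideal =
  fixes M :: "'a measure" and E :: "('a \<Rightarrow> real) set" and N :: "('a \<Rightarrow> real) \<Rightarrow> real"
  assumes space: "quasi_Banach_ideal_space M E N"
begin

lemma in_measurable: "x \<in> E \<Longrightarrow> x \<in> borel_measurable M"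
  using space unfolding quasi_Banach_ideal_space_def by blast

lemma zero_in: "(\<lambda>t. 0) \<in> E"
  and add_in: "x \<in> E \<Longrightarrow> y \<in> E \<Longrightarrow> (\<lambda>t. x t + y t) \<in> E"
  and scale_in: "x \<in> E \<Longrightarrow> (\<lambda>t. c * x t) \<in> E"
  using space unfolding quasi_Banach_ideal_space_def function_subspace_def by blast+

lemma N_nonneg: "x \<in> E \<Longrightarrow> 0 \<le> N x"
  and N_eq_0: "x \<in> E \<Longrightarrow> N x = 0 \<longleftrightarrow> (AE t in M. x t = 0)"
  and N_scale: "x \<in> E \<Longrightarrow> N (\<lambda>t. c * x t) = \<bar>c\<bar> * N x"
  and N_quasi_triangle: "\<exists>C\<ge>1. \<forall>x\<in>E. \<forall>y\<in>E. N (\<lambda>t. x t + y t) \<le> C * (N x + N y)"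
  using space unfolding quasi_Banach_ideal_space_def quasi_norm_on_def by blast+

lemma ideal:
  assumes "x \<in> borel_measurable M" "y \<in> E" "AE t in M. \<bar>x t\<bar> \<le> \<bar>y t\<bar>"
  shows "x \<in> E" "N x \<le> N y"
  using space assms unfolding quasi_Banach_ideal_space_def by blast+

lemma N_zero: "N (\<lambda>t. 0) = 0"
  using N_eq_0[OF zero_in] by simp

text \<open>
  Adding the first term last makes the bound reproduce itself: if the tail from $m+1$ on is at most
  $(2C)^{-(m+1)}$, then the sum from $m$ on is at most $C \cdot 2 (2C)^{-(m+1)} = (2C)^{-m}$.
\<close>

lemma geometric_quasi_triangle:
  assumes C: "1 \<le> C" "\<And>x y. x \<in> E \<Longrightarrow> y \<in> E \<Longrightarrow> N (\<lambda>t. x t + y t) \<le> C * (N x + N y)"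
    and f: "\<And>j. f j \<in> E" "\<And>j. N (f j) \<le> (1 / (2 * C)) ^ (j + 1)"
  shows "(\<lambda>t. \<Sum>j\<in>{m..<m+n}. f j t) \<in> E \<and> N (\<lambda>t. \<Sum>j\<in>{m..<m+n}. f j t) \<le> (1 / (2 * C)) ^ m"
proof (induction n arbitrary: m)
  case 0
  then show ?case using zero_in C by (simp add: N_zero)
next
  case (Suc n)
  have split: "(\<Sum>j\<in>{m..<m + Suc n}. f j t) = f m t + (\<Sum>j\<in>{Suc m..<Suc m + n}. f j t)" for t
    by (subst sum.atLeast_Suc_lessThan) auto
  have "N (\<lambda>t. f m t + (\<Sum>j\<in>{Suc m..<Suc m + n}. f j t))
      \<le> C * (N (f m) + N (\<lambda>t. \<Sum>j\<in>{Suc m..<Suc m + n}. f j t))"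
    using Suc[of "Suc m"] f by (intro C) auto
  also have "\<dots> \<le> C * ((1 / (2 * C)) ^ (m + 1) + (1 / (2 * C)) ^ Suc m)"
    using Suc[of "Suc m"] f(2)[of m] C(1) by (intro mult_left_mono add_mono) auto
  also have "\<dots> = (1 / (2 * C)) ^ m" using C(1) by simp
  finally show ?case unfolding split using Suc[of "Suc m"] add_in f by auto
qed

text \<open>
  An order continuous element $e$ that is not null satisfies $|e| \ge 1/(m+1)$ on a set $A$ of positive
  measure, for some $m$. There $\chi_A \le (m+1)|e|$, so indicator functions of subsets of $A$ inherit the order
  continuity of $e$.
\<close>

lemma order_continuous_set:
  assumes "order_continuous_part M E N \<noteq> null_functions M"
  obtains A where "A \<in> sets M" "0 < emeasure M A" "indicat_real A \<in> E"
    "\<And>X. (\<And>n. X n \<in> sets M) \<Longrightarrow> (\<And>n. X n \<subseteq> A) \<Longrightarrow>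
      (AE t in M. \<forall>\<^sub>F n in sequentially. t \<notin> X n) \<Longrightarrow> (\<lambda>n. N (indicat_real (X n))) \<longlonglongrightarrow> 0"
proof -
  have "null_functions M \<subseteq> order_continuous_part M E N"
  proof
    fix x assume x: "x \<in> null_functions M"
    then have "x \<in> E" by (auto simp: null_functions_def intro!: ideal(1)[OF _ zero_in])
    moreover have "(\<lambda>n. N (X n)) \<longlonglongrightarrow> 0"
      if X: "\<And>n. X n \<in> borel_measurable M" "\<And>n. AE t in M. 0 \<le> X n t \<and> X n t \<le> \<bar>x t\<bar>" for X :: "nat \<Rightarrow> 'a \<Rightarrow> real"
    proof -
      have "AE t in M. X n t = 0" for n
        using X(2)[of n] x by (auto simp: null_functions_def)
      then have "X n \<in> E \<and> N (X n) \<le> 0" for n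
        using ideal[OF X(1) zero_in, of n] by (auto simp: N_zero)
      then have "N (X n) = 0" for n using N_nonneg by (meson antisym)
      then show ?thesis by simp
    qed
    ultimately show "x \<in> order_continuous_part M E N"
      by (auto simp: order_continuous_part_def)
  qed
  then obtain e where e: "e \<in> order_continuous_part M E N" "e \<notin> null_functions M"
    using assms by blast
  then have eE: "e \<in> E" and eM[measurable]: "e \<in> borel_measurable M"
    using in_measurable by (auto simp: order_continuous_part_def)
  have "\<exists>m. emeasure M {t \<in> space M. 1 / real (Suc m) \<le> \<bar>e t\<bar>} \<noteq> 0"
  proof (rule ccontr)
    assume "\<not> ?thesis"
    then have "{t \<in> space M. 1 / real (Suc m) \<le> \<bar>e t\<bar>} \<in> null_sets M" for m by auto
    then have "AE t in M. t \<notin> {t \<in> space M. 1 / real (Suc m) \<le> \<bar>e t\<bar>}" for m by (rule AE_not_in)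
    then have "AE t in M. \<forall>m. t \<notin> {t \<in> space M. 1 / real (Suc m) \<le> \<bar>e t\<bar>}"
      by (simp add: AE_all_countable)
    then have "AE t in M. e t = 0"
      using AE_space
    proof eventually_elim
      case (elim t)
      then have le: "\<bar>e t\<bar> < 1 / real (Suc m)" for m by (auto simp: not_le)
      show ?case
      proof (rule ccontr)
        assume "e t \<noteq> 0"
        then obtain m where "inverse (real (Suc m)) < \<bar>e t\<bar>" using reals_Archimedean[of "\<bar>e t\<bar>"] by auto
        then show False using le[of m] by (simp add: inverse_eq_divide)
      qed
    qed
    then show False using e(2) by (auto simp: null_functions_def)
  qed
  then obtain m where m: "emeasure M {t \<in> space M. 1 / real (Suc m) \<le> \<bar>e t\<bar>} \<noteq> 0" by blast
  define A where "A = {t \<in> space M. 1 / real (Suc m) \<le> \<bar>e t\<bar>}"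
  have A: "A \<in> sets M" "0 < emeasure M A" using m by (auto simp: A_def zero_less_iff_neq_zero)
  have Ae: "indicator A t \<le> real (Suc m) * \<bar>e t\<bar>" for t
    by (auto simp: A_def indicator_def field_simps)
  have inE: "indicat_real B \<in> E" if "B \<in> sets M" "B \<subseteq> A" for B
  proof (rule ideal(1)[OF _ scale_in[OF eE, of "real (Suc m)"]])
    show "AE t in M. \<bar>indicat_real B t\<bar> \<le> \<bar>real (Suc m) * e t\<bar>"
    proof (rule AE_I2)
      fix t
      have "indicat_real B t \<le> indicator A t" using that by (auto simp: indicator_def)
      also note Ae[of t]
      finally show "\<bar>indicat_real B t\<bar> \<le> \<bar>real (Suc m) * e t\<bar>" by (simp add: abs_mult)
    qed
  qed (use that in auto)
  show ?thesis
  proof (rule that[OF A])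
    show "indicat_real A \<in> E" using inE A by blast
    fix X assume X: "\<And>n. X n \<in> sets M" "\<And>n. X n \<subseteq> A" "AE t in M. \<forall>\<^sub>F n in sequentially. t \<notin> X n"
    define Y where "Y n t = 1 / real (Suc m) * indicat_real (X n) t" for n t
    have "(\<lambda>n. N (Y n)) \<longlonglongrightarrow> 0"
    proof -
      have "\<forall>n. Y n \<in> borel_measurable M" using X(1) by (auto simp: Y_def[abs_def])
      moreover have "\<forall>n. AE t in M. 0 \<le> Y n t \<and> Y n t \<le> \<bar>e t\<bar>"
      proof (intro allI AE_I2)
        fix n t
        have "t \<in> X n \<Longrightarrow> t \<in> A" using X(2) by blast
        then show "0 \<le> Y n t \<and> Y n t \<le> \<bar>e t\<bar>" by (auto simp: Y_def A_def indicator_def)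
      qed
      moreover have "AE t in M. (\<lambda>n. Y n t) \<longlonglongrightarrow> 0"
        using X(3)
      proof eventually_elim
        case (elim t)
        have "\<forall>\<^sub>F n in sequentially. Y n t = 0"
          using elim by eventually_elim (simp add: Y_def)
        then show ?case by (rule tendsto_eventually)
      qed
      ultimately show ?thesis using e(1) by (auto simp: order_continuous_part_def)
    qed
    then have "(\<lambda>n. real (Suc m) * N (Y n)) \<longlonglongrightarrow> real (Suc m) * 0" by (intro tendsto_intros)
    moreover have "real (Suc m) * N (Y n) = N (indicat_real (X n))" for n
      unfolding Y_def by (subst N_scale[OF inE[OF X(1,2)]]) simp
    ultimately show "(\<lambda>n. N (indicat_real (X n))) \<longlonglongrightarrow> 0" by (simp only: mult_zero_right)
  qed
qed

lemma rho_mono: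
  assumes mono: "mono_on {0..} \<phi>" and x: "x \<in> borel_measurable M"
    and le: "\<And>t. \<bar>x t\<bar> \<le> \<bar>y t\<bar>"
  shows "rho M E N \<phi> x \<le> rho M E N \<phi> y"
proof (cases "(AE t in M. \<phi> \<bar>y t\<bar> < \<infinity>) \<and> (\<lambda>t. enn2real (\<phi> \<bar>y t\<bar>)) \<in> E")
  case True
  have phi_le: "\<phi> \<bar>x t\<bar> \<le> \<phi> \<bar>y t\<bar>" for t
    using le[of t] by (intro mono_onD[OF mono]) auto
  have fin: "AE t in M. \<phi> \<bar>x t\<bar> < \<infinity>"
    using True by (auto intro: le_less_trans[OF phi_le])
  have "AE t in M. \<bar>enn2real (\<phi> \<bar>x t\<bar>)\<bar> \<le> \<bar>enn2real (\<phi> \<bar>y t\<bar>)\<bar>"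
    using True phi_le by (auto intro!: enn2real_mono)
  moreover have "(\<lambda>t. enn2real (\<phi> \<bar>x t\<bar>)) \<in> borel_measurable M"
    using measurable_compose[OF x borel_measurable_mono_on_nonneg_abs[OF mono]] by measurable
  ultimately have "(\<lambda>t. enn2real (\<phi> \<bar>x t\<bar>)) \<in> E"
      "N (\<lambda>t. enn2real (\<phi> \<bar>x t\<bar>)) \<le> N (\<lambda>t. enn2real (\<phi> \<bar>y t\<bar>))"
    using ideal True by blast+
  then show ?thesis using True fin by (simp add: rho_def ennreal_leI)
next
  case False
  then have "rho M E N \<phi> y = \<infinity>" unfolding rho_def by (rule if_not_P)
  then show ?thesis by simp
qed

text \<open>
  This covers both ways in which the modular can exceed $1$: for $\varphi(c) = \infty$ it is infinite because
  $B$ is not null, and for $\varphi(c) < \infty$ it equals $\varphi(c) \|\chi_B\|$.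
\<close>

lemma rho_scaled_indicator_gt_1:
  assumes zero: "\<phi> 0 = 0" and B: "B \<in> sets M" "0 < emeasure M B" "indicat_real B \<in> E"
    and c: "0 \<le> c" and big: "ennreal (1 / N (indicat_real B)) < \<phi> c"
  shows "\<not> rho M E N \<phi> (\<lambda>t. c * indicator B t) \<le> 1"
proof
  assume le: "rho M E N \<phi> (\<lambda>t. c * indicator B t) \<le> 1"
  then have fin: "AE t in M. \<phi> \<bar>c * indicator B t\<bar> < \<infinity>"
    and eq: "rho M E N \<phi> (\<lambda>t. c * indicator B t) = ennreal (N (\<lambda>t. enn2real (\<phi> \<bar>c * indicator B t\<bar>)))"
    by (auto simp: rho_def top_unique split: if_splits)
  have notnull: "\<not> (AE t in M. t \<notin> B)"
    using B AE_iff_null_sets[OF B(1)] by auto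
  have cfin: "\<phi> c < \<infinity>"
  proof (rule ccontr)
    assume "\<not> \<phi> c < \<infinity>"
    with fin have "AE t in M. t \<notin> B" using c by (auto simp: indicator_def split: if_splits elim!: eventually_mono)
    then show False using notnull by blast
  qed
  have pos: "0 < N (indicat_real B)"
    using N_nonneg[OF B(3)] N_eq_0[OF B(3)] notnull by (auto simp: order.order_iff_strict indicator_eq_0_iff)
  have "(\<lambda>t. enn2real (\<phi> \<bar>c * indicator B t\<bar>)) = (\<lambda>t. enn2real (\<phi> c) * indicator B t)"
    using c zero by (auto simp: indicator_def fun_eq_iff)
  then have "ennreal (enn2real (\<phi> c) * N (indicat_real B)) \<le> 1"
    using le eq N_scale[OF B(3), of "enn2real (\<phi> c)"] by simp
  then have "enn2real (\<phi> c) * N (indicat_real B) \<le> 1" by simp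
  then have "enn2real (\<phi> c) \<le> 1 / N (indicat_real B)" using pos by (simp add: field_simps)
  then have "\<phi> c \<le> ennreal (1 / N (indicat_real B))" using cfin by (metis ennreal_enn2real ennreal_leI infinity_ennreal_def)
  then show False using big by simp
qed

text \<open>
  The partial sums of $\varphi(s) = \sum_j \varphi(u_j) \chi_{A_j}$ have quasi-norm at most $1$, and they
  increase to $\varphi(s)$. The Fatou property therefore puts $\varphi(s)$ into $E$ and keeps the bound.
\<close>

lemma rho_step_function_le_1:
  assumes Fatou: "Fatou_property M E N" and mono: "mono_on {0..} \<phi>" and zero: "\<phi> 0 = 0"
    and C: "1 \<le> C" "\<And>x y. x \<in> E \<Longrightarrow> y \<in> E \<Longrightarrow> N (\<lambda>t. x t + y t) \<le> C * (N x + N y)"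
    and A: "disjoint_family A" "\<And>j. A j \<in> sets M" "\<And>j. indicat_real (A j) \<in> E"
    and u: "\<And>j. 0 \<le> u j" "\<And>j. \<phi> (u j) < \<infinity>"
    and small: "\<And>j. enn2real (\<phi> (u j)) * N (indicat_real (A j)) \<le> (1 / (2 * C)) ^ (j + 1)"
  shows "rho M E N \<phi> (step_function A u) \<le> 1"
proof -
  define f where "f j t = enn2real (\<phi> (u j)) * indicat_real (A j) t" for j t
  define g where "g t = enn2real (\<phi> \<bar>step_function A u t\<bar>)" for t
  have f: "f j \<in> E" "N (f j) \<le> (1 / (2 * C)) ^ (j + 1)" for j
    using scale_in[OF A(3)] small[of j] N_scale[OF A(3)] by (simp_all add: f_def[abs_def])
  have part: "(\<lambda>t. \<Sum>j<n. f j t) \<in> E" "N (\<lambda>t. \<Sum>j<n. f j t) \<le> 1" for n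
  proof -
    have "(\<lambda>t. \<Sum>j\<in>{0..<0+n}. f j t) \<in> E \<and> N (\<lambda>t. \<Sum>j\<in>{0..<0+n}. f j t) \<le> (1 / (2 * C)) ^ 0"
    proof (rule geometric_quasi_triangle[where f = f and C = C and m = 0 and n = n])
      show "1 \<le> C" by (rule C)
      show "N (\<lambda>t. x t + y t) \<le> C * (N x + N y)" if "x \<in> E" "y \<in> E" for x y
        using that by (rule C)
      show "f j \<in> E" for j by (rule f)
      show "N (f j) \<le> (1 / (2 * C)) ^ (j + 1)" for j by (rule f)
    qed
    then show "(\<lambda>t. \<Sum>j<n. f j t) \<in> E" "N (\<lambda>t. \<Sum>j<n. f j t) \<le> 1"
      by (simp_all only: add_0 atLeast0LessThan power_0)
  qed
  have fin: "\<phi> \<bar>step_function A u t\<bar> < \<infinity>" for t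
    using step_function_in[OF A(1), of t _ u] step_function_out[of t A u] u zero
    by (cases "t \<in> (\<Union>n. A n)") auto
  have lim: "(\<lambda>n. \<Sum>j<n. f j t) \<longlonglongrightarrow> g t" for t
  proof (cases "t \<in> (\<Union>n. A n)")
    case True
    then obtain i where i: "t \<in> A i" by blast
    then have "g t = enn2real (\<phi> (u i))"
      using step_function_in[OF A(1) i, of u] u by (simp add: g_def)
    then show ?thesis
      using disjoint_indicator_sums[OF A(1) i, of "\<lambda>j. enn2real (\<phi> (u j))"]
      by (simp add: sums_def f_def)
  next
    case False
    then show ?thesis by (simp add: f_def g_def step_function_out zero)
  qed
  have gM: "g \<in> borel_measurable M"
    using measurable_compose[OF step_function_measurable borel_measurable_mono_on_nonneg_abs[OF mono]] A(2)
    unfolding g_def[abs_def] by measurable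
  have "g \<in> E \<and> (\<lambda>n. N (\<lambda>t. \<Sum>j<n. f j t)) \<longlonglongrightarrow> N g"
  proof (rule Fatou[unfolded Fatou_property_def, rule_format, OF gM], intro conjI allI AE_I2)
    show "(\<lambda>t. \<Sum>j<n. f j t) \<in> E" for n by (rule part)
    show "0 \<le> (\<Sum>j<n. f j t)" for n t by (auto simp: f_def intro!: sum_nonneg)
    show "incseq (\<lambda>n. \<Sum>j<n. f j t)" for t
      by (rule incseq_SucI) (simp add: f_def del: sum_mult_indicator)
    show "(\<lambda>n. \<Sum>j<n. f j t) \<longlonglongrightarrow> \<bar>g t\<bar>" for t using lim[of t] by (simp add: g_def)
    show "bdd_above (range (\<lambda>n. N (\<lambda>t. \<Sum>j<n. f j t)))"
      by (rule bdd_aboveI2) (rule part)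
  qed
  then have gE: "g \<in> E" and "N g \<le> 1"
    using LIMSEQ_le_const2[of _ "N g" 1] part by blast+
  then show ?thesis using fin by (simp add: rho_def g_def[abs_def])
qed

section \<open>Order isometric copies of $l_\infty$\<close>

text \<open>
  For $Pz = s \sum_n z_n \chi_{G_n}$ and $l > 0$, one has $\rho(Pz/l) \le 1$ exactly when $\|z\| \le l$:
  if $\|z\| \le l$ then $|Pz|/l \le s$, and if $|z_n| > l$ then $|Pz|/l \ge \lambda s \chi_{G_n}$ with
  $\lambda = |z_n|/l > 1$. Disjointness makes $P$ linear and compatible with absolute values pointwise.
\<close>

lemma order_isometric_l_infinityI:
  fixes G :: "nat \<Rightarrow> 'a set"
  assumes mono: "mono_on {0..} \<phi>"
    and s: "s \<in> borel_measurable M" "\<And>t. 0 \<le> s t" "rho M E N \<phi> s \<le> 1"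
    and G: "disjoint_family G" "\<And>n. G n \<in> sets M"
    and big: "\<And>n l. 1 < l \<Longrightarrow> \<not> rho M E N \<phi> (\<lambda>t. l * s t * indicator (G n) t) \<le> 1"
  shows "contains_order_isometric_l_infinity M (CL_space M E N \<phi>) (CL_norm M E N \<phi>)"
proof -
  define P where "P z t = s t * step_function G z t" for z t
  have P_in: "P z t = s t * z n" if "t \<in> G n" for z t n
    using step_function_in[OF G(1) that] by (simp add: P_def)
  have P_out: "P z t = 0" if "t \<notin> (\<Union>n. G n)" for z t
    using step_function_out[OF that] by (simp add: P_def)
  have PM: "(\<lambda>t. c * P z t) \<in> borel_measurable M" for z c
    unfolding P_def using s(1) step_function_measurable[of G M z] G(2) by measurable
  have z_le: "\<bar>z n\<bar> \<le> l_infinity_norm z" if "z \<in> l_infinity" for z n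
  proof -
    have "bdd_above (range (\<lambda>n. \<bar>z n\<bar>))"
      using that by (auto simp: l_infinity_def bounded_iff)
    then show ?thesis unfolding l_infinity_norm_def by (intro cSUP_upper) auto
  qed
  have norm_le: "l_infinity_norm z \<le> b" if "\<And>n. \<bar>z n\<bar> \<le> b" for z b
    unfolding l_infinity_norm_def using that by (intro cSUP_least) auto
  have rho_P: "rho M E N \<phi> (\<lambda>t. P z t / l) \<le> 1 \<longleftrightarrow> l_infinity_norm z \<le> l"
    if z: "z \<in> l_infinity" and l: "0 < l" for z l
  proof
    assume le: "l_infinity_norm z \<le> l"
    have "\<bar>P z t / l\<bar> \<le> \<bar>s t\<bar>" for t
    proof (cases "t \<in> (\<Union>n. G n)")
      case True
      then obtain n where n: "t \<in> G n" by blast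
      have "\<bar>z n\<bar> \<le> l" using z_le[OF z, of n] le by simp
      then have "s t * \<bar>z n\<bar> \<le> s t * l" using s(2) by (intro mult_left_mono) auto
      then show ?thesis using s(2)[of t] l by (simp add: P_in[OF n] abs_mult field_simps)
    qed (use P_out in simp)
    then have "rho M E N \<phi> (\<lambda>t. P z t / l) \<le> rho M E N \<phi> s"
      using PM[of "1 / l" z] by (intro rho_mono[OF mono]) auto
    then show "rho M E N \<phi> (\<lambda>t. P z t / l) \<le> 1" using s(3) by simp
  next
    assume le: "rho M E N \<phi> (\<lambda>t. P z t / l) \<le> 1"
    show "l_infinity_norm z \<le> l"
    proof (rule norm_le, rule ccontr)
      fix n assume "\<not> \<bar>z n\<bar> \<le> l"
      then have gt: "1 < \<bar>z n\<bar> / l" using l by simp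
      have "rho M E N \<phi> (\<lambda>t. \<bar>z n\<bar> / l * s t * indicator (G n) t) \<le> rho M E N \<phi> (\<lambda>t. P z t / l)"
      proof (rule rho_mono[OF mono])
        show "(\<lambda>t. \<bar>z n\<bar> / l * s t * indicator (G n) t) \<in> borel_measurable M"
          using s(1) G(2) by measurable
        show "\<bar>\<bar>z n\<bar> / l * s t * indicator (G n) t\<bar> \<le> \<bar>P z t / l\<bar>" for t
          using l P_in[of t n z] by (cases "t \<in> G n") (auto simp: abs_mult field_simps)
      qed
      then show False using le big[OF gt, of n] by (meson order_trans)
    qed
  qed
  have norm_eq: "CL_norm M E N \<phi> (P z) = ennreal (l_infinity_norm z)" if z: "z \<in> l_infinity" for z
  proof -
    have nn: "0 \<le> l_infinity_norm z" using z_le[OF z, of 0] by linarith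
    have set_eq: "{l. 0 < l \<and> rho M E N \<phi> (\<lambda>t. P z t / l) \<le> 1} = {l. 0 < l \<and> l_infinity_norm z \<le> l}"
      using rho_P[OF z] by blast
    show ?thesis
      unfolding CL_norm_def set_eq
    proof (rule antisym)
      show "ennreal (l_infinity_norm z) \<le> Inf (ennreal ` {l. 0 < l \<and> l_infinity_norm z \<le> l})"
        by (auto intro!: INF_greatest ennreal_leI)
      show "Inf (ennreal ` {l. 0 < l \<and> l_infinity_norm z \<le> l}) \<le> ennreal (l_infinity_norm z)"
      proof (rule ennreal_le_epsilon)
        fix e :: real assume "0 < e"
        then have "Inf (ennreal ` {l. 0 < l \<and> l_infinity_norm z \<le> l}) \<le> ennreal (l_infinity_norm z + e)"
          using nn by (intro INF_lower) auto
        then show "Inf (ennreal ` {l. 0 < l \<and> l_infinity_norm z \<le> l}) \<le> ennreal (l_infinity_norm z) + ennreal e"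
          using nn \<open>0 < e\<close> by (simp add: ennreal_plus)
      qed
    qed
  qed
  have P_mem: "P z \<in> CL_space M E N \<phi>" if z: "z \<in> l_infinity" for z
  proof -
    define l where "l = l_infinity_norm z + 1"
    have l: "0 < l" "l_infinity_norm z \<le> l" using z_le[OF z, of 0] by (auto simp: l_def)
    then have "rho M E N \<phi> (\<lambda>t. P z t / l) \<le> 1" using rho_P[OF z] by blast
    then have "rho M E N \<phi> (\<lambda>t. 1 / l * P z t) < \<infinity>"
      by (simp add: le_less_trans[of _ 1])
    then show ?thesis using l PM[of 1 z] by (auto simp: CL_space_def intro!: exI[of _ "1 / l"])
  qed
  have pointwise: "P (\<lambda>n. z n + w n) t = P z t + P w t"
    "P (\<lambda>n. c * z n) t = c * P z t" "\<bar>P z t\<bar> = P (\<lambda>n. \<bar>z n\<bar>) t" for z w c t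
    using P_in[of t] P_out[of t] s(2)[of t]
    by (cases "t \<in> (\<Union>n. G n)"; force simp: abs_mult algebra_simps)+
  show ?thesis
    unfolding contains_order_isometric_l_infinity_def
    using P_mem norm_eq pointwise by (intro exI[of _ P]) auto
qed

end

theorem theorem5p2:
  fixes M :: "'a measure"
    and E :: "('a \<Rightarrow> real) set"
    and N :: "('a \<Rightarrow> real) \<Rightarrow> real"
    and \<phi> :: "real \<Rightarrow> ennreal"
    and \<alpha> :: ereal
  assumes "complete_measure M"
    and "sigma_finite_measure M"
    and "emeasure M (space M) > 0"
    and "quasi_Banach_ideal_space M E N"
    and "Fatou_property M E N"
    and "Orlicz_function \<phi>"
    and "a_phi \<phi> < b_phi \<phi>"
    and "is_alpha_E M E \<phi> \<alpha>"
    and "\<alpha> > 0"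
    and "nonatomic M"
    and "order_continuous_part M E N \<noteq> null_functions M"
    and "\<not> Delta2_infinity \<phi>"
  shows "contains_order_isometric_l_infinity M (CL_space M E N \<phi>) (CL_norm M E N \<phi>)"
proof -
  interpret quasi_Banach_ideal M E N by standard (rule assms(4))
  have mono: "mono_on {0..} \<phi>" and zero: "\<phi> 0 = 0"
    using assms(6) by (auto simp: Orlicz_function_def)
  obtain C where C: "1 \<le> C" "\<And>x y. x \<in> E \<Longrightarrow> y \<in> E \<Longrightarrow> N (\<lambda>t. x t + y t) \<le> C * (N x + N y)"
    using N_quasi_triangle by blast
  define \<nu> where "\<nu> B = N (indicat_real B)" for B
  obtain A where A: "A \<in> sets M" "0 < emeasure M A" "indicat_real A \<in> E"
    and cont: "\<And>X. (\<And>n. X n \<in> sets M) \<Longrightarrow> (\<And>n. X n \<subseteq> A) \<Longrightarrow>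
      (AE t in M. \<forall>\<^sub>F n in sequentially. t \<notin> X n) \<Longrightarrow> (\<lambda>n. \<nu> (X n)) \<longlonglongrightarrow> 0"
    unfolding \<nu>_def using order_continuous_set[OF assms(11)] by blast
  have inE: "indicat_real B \<in> E" if "B \<in> sets M" "B \<subseteq> A" for B
    using that by (intro ideal(1)[OF _ A(3)]) (auto simp: indicator_def)
  have \<nu>_pos: "0 < \<nu> B" if B: "B \<in> sets M" "B \<subseteq> A" "0 < emeasure M B" for B
  proof -
    have "\<not> (AE t in M. indicat_real B t = 0)"
      using B AE_iff_null_sets[OF B(1)] by (auto simp: indicator_eq_0_iff)
    then show ?thesis
      using N_nonneg N_eq_0 inE[OF B(1,2)] by (force simp: \<nu>_def order.order_iff_strict)
  qed
  have "indicat_real {} = (\<lambda>t::'a. 0)" by auto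
  then have \<nu>_empty: "\<nu> {} = 0" by (simp add: \<nu>_def N_zero)
  have \<nu>_Un: "\<nu> (B \<union> D) \<le> C * (\<nu> B + \<nu> D)"
    if "B \<in> sets M" "D \<in> sets M" "B \<subseteq> A" "D \<subseteq> A" for B D
  proof -
    have "N (indicat_real (B \<union> D)) \<le> N (\<lambda>t. indicat_real B t + indicat_real D t)"
      using that by (intro ideal(2)[OF _ add_in[OF inE inE]]) (auto simp: indicator_def)
    also have "\<dots> \<le> C * (\<nu> B + \<nu> D)"
      unfolding \<nu>_def using that by (intro C inE)
    finally show ?thesis by (simp add: \<nu>_def)
  qed
  obtain Q :: "nat \<Rightarrow> 'a set" where Q: "disjoint_family Q"
    "\<And>n. Q n \<in> sets M" "\<And>n. Q n \<subseteq> A" "\<And>n. 0 < emeasure M (Q n)"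
    using nonatomic_disjoint_positive_subsets[OF assms(10) A(1,2)] by blast
  obtain u0 where u0: "0 < u0" "0 < \<phi> u0" "\<phi> u0 < \<infinity>"
    using obtain_pos_finite_value[OF mono zero assms(7)] .
  define v0 where "v0 = enn2real (\<phi> u0)"
  have v0: "0 < v0" using u0 by (simp add: v0_def enn2real_positive_iff)
  \<comment> \<open>\<open>\<delta> j\<close> is the target for \<open>\<phi> (u j) * \<nu> (B j)\<close>, up to the factor \<open>2 * C\<close>. The first bound gives the geometric decay, and
    the second makes \<open>Q j\<close> large enough to contain \<open>B j\<close> before \<open>u j\<close> is known, as \<open>\<phi> (u j) \<ge> \<phi> u0\<close>.\<close>
  define \<delta> where "\<delta> j = min ((1 / (2 * C)) ^ (j + 2)) (\<nu> (Q j) * v0 / (2 * C))" for j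
  have \<delta>: "0 < \<delta> j" for j
    using C(1) v0 \<nu>_pos[OF Q(2,3,4)] by (simp add: \<delta>_def)
  \<comment> \<open>The index \<open>j\<close> codes a pair \<open>(n, k)\<close>: \<open>n\<close> names the set \<open>G n\<close> that will contain \<open>B j\<close>, and
    the factor \<open>l j = 1 + 1 / (k + 1)\<close> tends to 1 along each \<open>n\<close>.\<close>
  define l where "l j = 1 + inverse (real (Suc (snd (prod_decode j))))" for j
  have l: "1 < l j" for j by (simp add: l_def)
  \<comment> \<open>A growth factor \<open>1 / \<delta> j\<close> lifts a modular of about \<open>\<delta> j\<close> above 1.\<close>
  have "\<exists>u\<ge>u0. \<phi> u < \<infinity> \<and> ennreal (1 / \<delta> j) * \<phi> u < \<phi> (l j * u)" for j
    using not_Delta2_growth[OF mono u0(1,3) assms(12) l, of "1 / \<delta> j"] \<delta> by simp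
  then obtain u where u: "\<And>j. u0 \<le> u j" "\<And>j. \<phi> (u j) < \<infinity>"
    "\<And>j. ennreal (1 / \<delta> j) * \<phi> (u j) < \<phi> (l j * u j)" by metis
  have u_nonneg: "0 \<le> u j" for j using u0(1) u(1)[of j] by (rule order_trans[OF less_imp_le])
  define v where "v j = enn2real (\<phi> (u j))" for j
  have v_ge: "v0 \<le> v j" for j
    unfolding v0_def v_def using u(1,2)[of j] u0(1) u_nonneg[of j]
    by (intro enn2real_mono mono_onD[OF mono]) simp_all
  have v_pos: "0 < v j" for j using v_ge[of j] v0 by simp
  have "\<exists>B\<in>sets M. B \<subseteq> Q j \<and> \<delta> j / v j \<le> \<nu> B \<and> \<nu> B \<le> 2 * C * (\<delta> j / v j)" for j
  proof (rule subset_of_comparable_size[where A = "Q j" and C = C and e = "\<delta> j / v j" and \<nu> = \<nu>, OF assms(10) Q(2) C(1)])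
    show "0 < \<delta> j / v j" using \<delta> v_pos by simp
    show "\<nu> {} = 0" by (rule \<nu>_empty)
    show "0 < \<nu> B" if "B \<in> sets M" "B \<subseteq> Q j" "0 < emeasure M B" for B
      using that Q(3)[of j] by (intro \<nu>_pos) auto
    show "\<nu> (B \<union> D) \<le> C * (\<nu> B + \<nu> D)"
      if "B \<in> sets M" "D \<in> sets M" "B \<subseteq> Q j" "D \<subseteq> Q j" for B D
      using that Q(3)[of j] by (intro \<nu>_Un) auto
    show "(\<lambda>n. \<nu> (X n)) \<longlonglongrightarrow> 0"
      if "\<And>n. X n \<in> sets M" "\<And>n. X n \<subseteq> Q j" "AE t in M. \<forall>\<^sub>F n in sequentially. t \<notin> X n" for X
      using that Q(3)[of j] by (intro cont) blast+
    have "C * \<delta> j \<le> \<nu> (Q j) * v0 / 2"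
    proof -
      have "C * \<delta> j \<le> C * (\<nu> (Q j) * v0 / (2 * C))"
        using C(1) by (intro mult_left_mono) (auto simp: \<delta>_def)
      then show ?thesis using C(1) by simp
    qed
    also have "\<dots> < \<nu> (Q j) * v0" using \<nu>_pos[OF Q(2,3,4)] v0 by simp
    also have "\<dots> \<le> \<nu> (Q j) * v j"
      using v_ge \<nu>_pos[OF Q(2,3,4), of j] by (intro mult_left_mono) auto
    finally show "C * (\<delta> j / v j) < \<nu> (Q j)" using v_pos[of j] by (simp add: field_simps)
  qed blast
  then obtain B where B: "\<And>j. B j \<in> sets M" "\<And>j. B j \<subseteq> Q j" "\<And>j. \<delta> j / v j \<le> \<nu> (B j)"
    "\<And>j. \<nu> (B j) \<le> 2 * C * (\<delta> j / v j)" by metis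
  have BE: "indicat_real (B j) \<in> E" for j using B(1,2)[of j] Q(3)[of j] by (intro inE) auto
  have B_disj: "disjoint_family B"
    using Q(1) B(2) unfolding disjoint_family_on_def by blast
  have B_pos: "0 < emeasure M (B j)" for j
  proof (rule ccontr)
    assume "\<not> 0 < emeasure M (B j)"
    then have "AE t in M. indicat_real (B j) t = 0"
      using AE_iff_null_sets[OF B(1)] B(1) by (auto simp: indicator_eq_0_iff)
    then have "\<nu> (B j) = 0" using N_eq_0[OF BE] by (simp add: \<nu>_def)
    then show False using B(3)[of j] \<delta>[of j] v_pos[of j] by (simp add: divide_le_0_iff)
  qed
  define s where "s = step_function B u"
  define G where "G n = (\<Union>k. B (prod_encode (n, k)))" for n
  show ?thesis
  proof (rule order_isometric_l_infinityI[OF mono])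
    show "s \<in> borel_measurable M" unfolding s_def by (rule step_function_measurable[OF B(1)])
    show "0 \<le> s t" for t
      using step_function_in[OF B_disj, of t _ u] step_function_out[of t B u] u_nonneg
      by (cases "t \<in> (\<Union>n. B n)") (auto simp: s_def)
    show "rho M E N \<phi> s \<le> 1"
      unfolding s_def
    proof (rule rho_step_function_le_1[OF assms(5) mono zero C B_disj B(1) BE u_nonneg u(2)])
      fix j
      have "v j * \<nu> (B j) \<le> v j * (2 * C * (\<delta> j / v j))"
        using B(4) v_pos[of j] by (intro mult_left_mono) auto
      also have "\<dots> = 2 * C * \<delta> j" using v_pos[of j] by simp
      also have "\<dots> \<le> 2 * C * (1 / (2 * C)) ^ (j + 2)"
        using C(1) by (intro mult_left_mono) (auto simp: \<delta>_def)
      also have "\<dots> = (1 / (2 * C)) ^ (j + 1)" using C(1) by simp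
      finally show "enn2real (\<phi> (u j)) * N (indicat_real (B j)) \<le> (1 / (2 * C)) ^ (j + 1)"
        by (simp add: v_def \<nu>_def)
    qed
    show "disjoint_family G"
      unfolding disjoint_family_on_def
    proof (intro ballI impI)
      fix m n :: nat assume "m \<noteq> n"
      then have "B (prod_encode (m, i)) \<inter> B (prod_encode (n, k)) = {}" for i k
        by (intro disjoint_family_onD[OF B_disj]) auto
      then show "G m \<inter> G n = {}" unfolding G_def by blast
    qed
    show "G n \<in> sets M" for n unfolding G_def using B(1) by auto
    fix n and c :: real assume c: "1 < c"
    obtain k where k: "inverse (real (Suc k)) < c - 1" using reals_Archimedean[of "c - 1"] c by auto
    define j where "j = prod_encode (n, k)"
    have lj: "l j \<le> c" using k by (simp add: l_def j_def)
    have "\<not> rho M E N \<phi> (\<lambda>t. (l j * u j) * indicator (B j) t) \<le> 1"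
    proof (rule rho_scaled_indicator_gt_1[of \<phi>, OF zero B(1)[of j] B_pos[of j] BE[of j]])
      show "0 \<le> l j * u j" using l[of j] u_nonneg[of j] by simp
      have pos: "0 < \<delta> j / v j" using \<delta>[of j] v_pos[of j] by simp
      then have "1 / \<nu> (B j) \<le> 1 / (\<delta> j / v j)"
        using B(3)[of j] by (intro divide_left_mono mult_pos_pos) linarith+
      also have "\<dots> = 1 / \<delta> j * v j" by simp
      finally have "ennreal (1 / \<nu> (B j)) \<le> ennreal (1 / \<delta> j * v j)" by (rule ennreal_leI)
      also have "\<dots> = ennreal (1 / \<delta> j) * \<phi> (u j)"
        using \<delta>[of j] u(2)[of j] by (subst ennreal_mult) (auto simp: v_def)
      also have "\<dots> < \<phi> (l j * u j)" by (rule u(3))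
      finally show "ennreal (1 / N (indicat_real (B j))) < \<phi> (l j * u j)" by (simp add: \<nu>_def)
    qed
    moreover have "rho M E N \<phi> (\<lambda>t. (l j * u j) * indicator (B j) t) \<le> rho M E N \<phi> (\<lambda>t. c * s t * indicator (G n) t)"
    proof (rule rho_mono[OF mono])
      show "(\<lambda>t. (l j * u j) * indicator (B j) t) \<in> borel_measurable M" using B(1) by measurable
      fix t
      show "\<bar>(l j * u j) * indicator (B j) t\<bar> \<le> \<bar>c * s t * indicator (G n) t\<bar>"
      proof (cases "t \<in> B j")
        case True
        then have "t \<in> G n" "s t = u j"
          using step_function_in[OF B_disj True] by (auto simp: G_def j_def s_def)
        then show ?thesis using True lj l[of j] u_nonneg[of j] by (simp add: abs_mult mult_right_mono)
      qed simp
    qed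
    ultimately show "\<not> rho M E N \<phi> (\<lambda>t. c * s t * indicator (G n) t) \<le> 1"
      by (meson order_trans)
  qed
qed

end
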